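(* Let $f\in H^2(\mathbb{B})$ with $f(0)\neq0$, and for $n\in\mathbb{N}$ let $p_n$ be the optimal approximant of degree $n$ of $f^{-\ast}$. Let $(\varphi_k)_{k\ge0}$ be polynomials with $\varphi_k\in\mathcal{P}_k$ such that, for every $n\in\mathbb{N}$, $\{f\ast\varphi_k\}_{k=0}^n$ is an orthonormal basis of $f\ast\mathcal{P}_n$. Then the following are equivalent: (i) $f$ is cyclic; (ii) $p_n(0)$ converges to $f^{-\ast}(0)$ as $n\to\infty$; (iii) $\sum_{k=0}^\infty|\varphi_k(0)|^2=|f^{-\ast}(0)|^2$.
   Context: $\mathbb{H}$ is the skew field of quaternions, $\mathbb{B}=\{q\in\mathbb{H}:|q|<1\}$, and $\mathbb{N}$ includes $0$. $H^2(\mathbb{B})$ is the space of functions $f:\mathbb{B}\to\mathbb{H}$, $f(q)=\sum_{n\ge0}q^na_n$ with $a_n\in\mathbb{H}$ and $\|f\|_{H^2}^2=\sum_{n\ge0}|a_n|^2<\infty$; it is a right quaternionic Hilbert space with inner product $\langle\sum q^na_n,\sum q^nb_n\rangle=\sum_{n\ge0}\overline{b_n}a_n$. The $\ast$-product of $f=\sum q^na_n$ and $g=\sum q^nb_n$ is $f\ast g(q)=\sum_{n\ge0}q^n\sum_{k=0}^na_kb_{n-k}$. With $f^c(q)=\sum q^n\overline{a_n}$ and $f^s=f\ast f^c=f^c\ast f$, the $\ast$-inverse of $f$ is $f^{-\ast}(q)=(f^s(q))^{-1}f^c(q)$, defined where $f^s(q)\ne0$; it satisfies $f\ast f^{-\ast}=f^{-\ast}\ast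 f=1$. Let $\mathcal{P}_n=\{p(q)=\sum_{k=0}^nq^ka_k: a_k\in\mathbb{H}\}$ and $f\ast\mathcal{P}_n=\{f\ast p:p\in\mathcal{P}_n\}$. The optimal approximant of degree $n$ of $f^{-\ast}$ is the (unique) $p_n\in\mathcal{P}_n$ such that $\|f\ast p_n-1\|_{H^2}=\min\{\|f\ast p-1\|_{H^2}:p\in\mathcal{P}_n\}$. $f\in H^2(\mathbb{B})$ is cyclic if the closure in $H^2(\mathbb{B})$ of the right $\mathbb{H}$-linear span of $\{q^n\ast f:n\ge0\}$, i.e. of $\{f\ast p:p\in\bigcup_n\mathcal{P}_n\}$, is all of $H^2(\mathbb{B})$. *)

theory Defs
  imports "HOL-Analysis.Analysis"
begin

section \<open>Quaternions\<close>

codatatype quat = Quat (Qre: real) (Qi: real) (Qj: real) (Qk: real)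

lemma quat_eqI [intro?]:
  "Qre x = Qre y \<Longrightarrow> Qi x = Qi y \<Longrightarrow> Qj x = Qj y \<Longrightarrow> Qk x = Qk y \<Longrightarrow> x = y"
  by (rule quat.expand) simp

lemma quat_eq_iff:
  "x = y \<longleftrightarrow> Qre x = Qre y \<and> Qi x = Qi y \<and> Qj x = Qj y \<and> Qk x = Qk y"
  by (auto intro: quat_eqI)

instantiation quat :: ab_group_add
begin

primcorec zero_quat where
  "Qre 0 = 0" | "Qi 0 = 0" | "Qj 0 = 0" | "Qk 0 = 0"

primcorec plus_quat where
  "Qre (x + y) = Qre x + Qre y"
| "Qi (x + y) = Qi x + Qi y"
| "Qj (x + y) = Qj x + Qj y"
| "Qk (x + y) = Qk x + Qk y"

primcorec uminus_quat where
  "Qre (- x) = - Qre x"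
| "Qi (- x) = - Qi x"
| "Qj (- x) = - Qj x"
| "Qk (- x) = - Qk x"

primcorec minus_quat where
  "Qre (x - y) = Qre x - Qre y"
| "Qi (x - y) = Qi x - Qi y"
| "Qj (x - y) = Qj x - Qj y"
| "Qk (x - y) = Qk x - Qk y"

instance
  by standard (simp_all add: quat_eq_iff)

end

instantiation quat :: real_algebra_1
begin

primcorec one_quat where
  "Qre 1 = 1" | "Qi 1 = 0" | "Qj 1 = 0" | "Qk 1 = 0"

primcorec times_quat where
  "Qre (x * y) = Qre x * Qre y - Qi x * Qi y - Qj x * Qj y - Qk x * Qk y"
| "Qi (x * y) = Qre x * Qi y + Qi x * Qre y + Qj x * Qk y - Qk x * Qj y"
| "Qj (x * y) = Qre x * Qj y - Qi x * Qk y + Qj x * Qre y + Qk x * Qi y"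
| "Qk (x * y) = Qre x * Qk y + Qi x * Qj y - Qj x * Qi y + Qk x * Qre y"

primcorec scaleR_quat where
  "Qre (scaleR r x) = r * Qre x"
| "Qi (scaleR r x) = r * Qi x"
| "Qj (scaleR r x) = r * Qj x"
| "Qk (scaleR r x) = r * Qk x"

instance
  by standard (simp_all add: quat_eq_iff algebra_simps)

end

primcorec qcnj :: "quat \<Rightarrow> quat" where
  "Qre (qcnj x) = Qre x"
| "Qi (qcnj x) = - Qi x"
| "Qj (qcnj x) = - Qj x"
| "Qk (qcnj x) = - Qk x"

instantiation quat :: real_normed_div_algebra
begin

definition norm_quat :: "quat \<Rightarrow> real" where
  "norm x = sqrt ((Qre x)\<^sup>2 + (Qi x)\<^sup>2 + (Qj x)\<^sup>2 + (Qk x)\<^sup>2)"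

definition inverse_quat :: "quat \<Rightarrow> quat" where
  "inverse x = qcnj x /\<^sub>R ((Qre x)\<^sup>2 + (Qi x)\<^sup>2 + (Qj x)\<^sup>2 + (Qk x)\<^sup>2)"

definition divide_quat :: "quat \<Rightarrow> quat \<Rightarrow> quat" where
  "x div y = x * inverse y" for x y :: quat

definition sgn_quat :: "quat \<Rightarrow> quat" where
  "sgn x = x /\<^sub>R norm x" for x :: quat

definition dist_quat :: "quat \<Rightarrow> quat \<Rightarrow> real" where
  "dist x y = norm (x - y)" for x y :: quat

definition uniformity_quat :: "(quat \<times> quat) filter" where
  "uniformity_quat = (INF e\<in>{0 <..}. principal {(x, y). dist x y < e})"

definition open_quat :: "quat set \<Rightarrow> bool" where
  "open_quat U \<longleftrightarrow> (\<forall>x\<in>U. eventually (\<lambda>(x', y). x' = x \<longrightarrow> y \<in> U) uniformity)"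

instance
proof
  fix r :: real and x y :: quat and U :: "quat set"
  have sq0: "(Qre x)\<^sup>2 + (Qi x)\<^sup>2 + (Qj x)\<^sup>2 + (Qk x)\<^sup>2 = 0 \<longleftrightarrow> x = 0" for x
    by (simp add: quat_eq_iff add_nonneg_eq_0_iff)
  have pair: "norm x = norm (Complex (Qre x) (Qi x), Complex (Qj x) (Qk x))" for x
    by (simp add: norm_quat_def norm_Pair complex_norm add.assoc)
  show "norm x = 0 \<longleftrightarrow> x = 0"
    by (simp add: norm_quat_def sq0)
  show "norm (x + y) \<le> norm x + norm y"
    unfolding pair
    using norm_triangle_ineq[of "(Complex (Qre x) (Qi x), Complex (Qj x) (Qk x))"
        "(Complex (Qre y) (Qi y), Complex (Qj y) (Qk y))"]
    by (simp add: plus_complex.ctr)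
  show "norm (r *\<^sub>R x) = \<bar>r\<bar> * norm x"
    by (simp add: norm_quat_def power_mult_distrib distrib_left[symmetric] real_sqrt_mult)
  show "norm (x * y) = norm x * norm y"
    by (simp add: norm_quat_def real_sqrt_mult[symmetric] power2_eq_square algebra_simps)
  show "inverse x * x = 1" if "x \<noteq> 0"
  proof -
    let ?N = "(Qre x)\<^sup>2 + (Qi x)\<^sup>2 + (Qj x)\<^sup>2 + (Qk x)\<^sup>2"
    have "qcnj x * x = ?N *\<^sub>R 1"
      by (simp add: quat_eq_iff power2_eq_square)
    then show ?thesis
      using that sq0[of x] by (simp add: inverse_quat_def)
  qed
  show "x * inverse x = 1" if "x \<noteq> 0"
  proof -
    let ?N = "(Qre x)\<^sup>2 + (Qi x)\<^sup>2 + (Qj x)\<^sup>2 + (Qk x)\<^sup>2"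
    have "x * qcnj x = ?N *\<^sub>R 1"
      by (simp add: quat_eq_iff power2_eq_square)
    then show ?thesis
      using that sq0[of x] by (simp add: inverse_quat_def)
  qed
  show "inverse (0 :: quat) = 0"
    by (simp add: inverse_quat_def quat_eq_iff)
qed (rule divide_quat_def sgn_quat_def dist_quat_def uniformity_quat_def open_quat_def)+

end


section \<open>Slice regular power series on the unit ball\<close>

text \<open>
  Functions on the open unit ball are total functions on \<^typ>\<open>quat\<close> of which only the values
  on \<^term>\<open>ball (0::quat) 1\<close> matter; in particular membership in \<open>H2\<close> and the norm and inner
  product below do not depend on the values outside the ball.
\<close>

definition has_ps_coeffs :: "(quat \<Rightarrow> quat) \<Rightarrow> (nat \<Rightarrow> quat) \<Rightarrow> bool" where
  "has_ps_coeffs f a \<longleftrightarrow> (\<forall>q\<in>ball 0 1. (\<lambda>n. q ^ n * a n) sums f q)"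

definition ps_coeffs :: "(quat \<Rightarrow> quat) \<Rightarrow> nat \<Rightarrow> quat" where
  "ps_coeffs f = (THE a. has_ps_coeffs f a)"

lemma powser_eq_0_coeffs:
  fixes c :: "nat \<Rightarrow> real"
  assumes "\<And>t. norm t < 1 \<Longrightarrow> (\<lambda>n. c n * t ^ n) sums 0"
  shows "c m = 0"
proof (induction m rule: less_induct)
  case (less m)
  have "(\<lambda>n. c (n + m) * t ^ n) sums 0" if t: "t \<noteq> 0" "norm t < 1" for t :: real
  proof -
    have "(\<lambda>n. c (n + m) * t ^ (n + m)) sums 0"
      using sums_split_initial_segment[OF assms[OF t(2)], of m] less by simp
    from sums_mult[OF this, of "inverse (t ^ m)"]
    have "(\<lambda>n. inverse (t ^ m) * (c (n + m) * t ^ (n + m))) sums 0"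
      by simp
    moreover have "inverse (t ^ m) * (c (n + m) * t ^ (n + m)) = c (n + m) * t ^ n" for n
      using t(1) by (simp add: power_add)
    ultimately show ?thesis
      by simp
  qed
  then have "((\<lambda>t::real. 0) \<longlongrightarrow> c (0 + m)) (at 0)"
    by (intro powser_limit_0_strong[where s = 1 and a = "\<lambda>n. c (n + m)"]) auto
  then show ?case
    using tendsto_unique[OF at_neq_bot _ tendsto_const] by (simp only: add_0)
qed

lemma has_ps_coeffs_unique:
  assumes "has_ps_coeffs f a" "has_ps_coeffs f b"
  shows "a = b"
proof
  fix m
  have scal: "of_real t ^ k * c = (t ^ k) *\<^sub>R (c::quat)" for t :: real and k c
    by (simp add: scaleR_conv_of_real)
  have bl: "bounded_linear Qre" "bounded_linear Qi" "bounded_linear Qj" "bounded_linear Qk"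
    by (auto intro!: bounded_linear_intro[where K = 1] real_le_rsqrt simp: norm_quat_def)
  have comp: "C (a m) = C (b m)" if C: "bounded_linear C" for C :: "quat \<Rightarrow> real"
  proof -
    have "(\<lambda>n. C (a n - b n) * t ^ n) sums 0" if t: "norm t < 1" for t :: real
    proof -
      have "of_real t \<in> ball (0::quat) 1"
        using t by simp
      then have "(\<lambda>n. of_real t ^ n * a n) sums f (of_real t)"
        "(\<lambda>n. of_real t ^ n * b n) sums f (of_real t)"
        using assms unfolding has_ps_coeffs_def by blast+
      from sums_diff[OF this]
      have "(\<lambda>n. (t ^ n) *\<^sub>R (a n - b n)) sums 0"
        by (simp add: scal scaleR_diff_right)
      from bounded_linear.sums[OF C this] show ?thesis
        by (simp add: linear_simps[OF C] linear_0[OF bounded_linear.linear[OF C]] mult.commute)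
    qed
    then have "C (a m - b m) = 0"
      by (rule powser_eq_0_coeffs)
    then show ?thesis
      by (simp add: linear_simps[OF C])
  qed
  show "a m = b m"
    by (intro quat_eqI comp bl)
qed

lemma ps_coeffs_eqI: "has_ps_coeffs f a \<Longrightarrow> ps_coeffs f = a"
  unfolding ps_coeffs_def by (rule the_equality) (auto intro: has_ps_coeffs_unique)

definition star :: "(quat \<Rightarrow> quat) \<Rightarrow> (quat \<Rightarrow> quat) \<Rightarrow> quat \<Rightarrow> quat" (infixl \<open>\<star>\<close> 70) where
  "f \<star> g = (\<lambda>q. \<Sum>n. q ^ n * (\<Sum>k\<le>n. ps_coeffs f k * ps_coeffs g (n - k)))"

definition regular_conj :: "(quat \<Rightarrow> quat) \<Rightarrow> quat \<Rightarrow> quat" where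
  "regular_conj f = (\<lambda>q. \<Sum>n. q ^ n * qcnj (ps_coeffs f n))"

definition symmetrization :: "(quat \<Rightarrow> quat) \<Rightarrow> quat \<Rightarrow> quat" where
  "symmetrization f = f \<star> regular_conj f"

text \<open>Meaningful only at points where the symmetrization of \<open>f\<close> does not vanish; elsewhere the
  value is \<open>0\<close>, as \<^term>\<open>inverse (0::quat) = 0\<close>.\<close>

definition star_inverse :: "(quat \<Rightarrow> quat) \<Rightarrow> quat \<Rightarrow> quat" where
  "star_inverse f = (\<lambda>q. inverse (symmetrization f q) * regular_conj f q)"


section \<open>The Hardy space\<close>

definition H2 :: "(quat \<Rightarrow> quat) set" where
  "H2 = {f. \<exists>a. has_ps_coeffs f a \<and> summable (\<lambda>n. (norm (a n))\<^sup>2)}"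

definition H2_norm :: "(quat \<Rightarrow> quat) \<Rightarrow> real" where
  "H2_norm f = sqrt (\<Sum>n. (norm (ps_coeffs f n))\<^sup>2)"

definition H2_inner :: "(quat \<Rightarrow> quat) \<Rightarrow> (quat \<Rightarrow> quat) \<Rightarrow> quat" where
  "H2_inner f g = (\<Sum>n. qcnj (ps_coeffs g n) * ps_coeffs f n)"

definition H2_closure :: "(quat \<Rightarrow> quat) set \<Rightarrow> (quat \<Rightarrow> quat) set" where
  "H2_closure S = {g \<in> H2. \<forall>e>0. \<exists>h\<in>S. H2_norm (\<lambda>q. h q - g q) < e}"

definition right_span :: "(quat \<Rightarrow> quat) set \<Rightarrow> (quat \<Rightarrow> quat) set" where
  "right_span S = {h. \<exists>F c. finite F \<and> F \<subseteq> S \<and> (\<forall>q\<in>ball 0 1. h q = (\<Sum>g\<in>F. g q * c g))}"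

definition polys :: "nat \<Rightarrow> (quat \<Rightarrow> quat) set" where
  "polys n = {p. \<exists>a. p = (\<lambda>q. \<Sum>k\<le>n. q ^ k * a k)}"

text \<open>The family \<open>e 0, ..., e n\<close> is an orthonormal basis of \<open>V\<close> as a right quaternionic space;
  equality of functions in the span is equality on the ball.\<close>

definition orthonormal_basis :: "nat \<Rightarrow> (nat \<Rightarrow> quat \<Rightarrow> quat) \<Rightarrow> (quat \<Rightarrow> quat) set \<Rightarrow> bool" where
  "orthonormal_basis n e V \<longleftrightarrow>
     (\<forall>k\<le>n. e k \<in> V) \<and>
     (\<forall>j\<le>n. \<forall>k\<le>n. H2_inner (e j) (e k) = (if j = k then 1 else 0)) \<and>
     V \<subseteq> right_span (e ` {..n})"

definition optimal_approximant :: "(quat \<Rightarrow> quat) \<Rightarrow> nat \<Rightarrow> (quat \<Rightarrow> quat) \<Rightarrow> bool" where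
  "optimal_approximant f n p \<longleftrightarrow>
     p \<in> polys n \<and>
     (\<forall>r\<in>polys n. H2_norm (\<lambda>q. (f \<star> p) q - 1) \<le> H2_norm (\<lambda>q. (f \<star> r) q - 1))"

text \<open>The \<open>H2_closure\<close> of a set is by definition a subset of \<open>H2\<close>, so the equality below says
  that the span is dense.\<close>

definition cyclic :: "(quat \<Rightarrow> quat) \<Rightarrow> bool" where
  "cyclic f \<longleftrightarrow> f \<in> H2 \<and> H2_closure (right_span (range (\<lambda>n. (\<lambda>q. q ^ n) \<star> f))) = H2"

end

theory Submission
  imports Defs
begin

text \<open>
  Coefficientwise, \<open>H2\<close> is the space of square-summable quaternion sequences, \<open>f \<star> r\<close> is a
  convolution, and \<open>f \<star> q ^ j c\<close> is a shift of the coefficients followed by right multiplication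
  by the quaternion \<open>c\<close>.

  Expand the elements of \<open>f \<star> polys n\<close> in the orthonormal basis
  \<open>e k = f \<star> \<phi> k\<close>.  Pairing with \<open>1\<close> only sees the coefficient at \<open>0\<close>, so completing the square
  gives, for all coefficients \<open>d\<close>,
  \<open>|\<Sum>k\<le>n. e k d k - 1|\<^sup>2 = 1 - S n + (\<Sum>k\<le>n. |d k - conj (e k 0)|\<^sup>2)\<close>, where
  \<open>S n = (\<Sum>k\<le>n. |e k 0|\<^sup>2) = |f 0|\<^sup>2 (\<Sum>k\<le>n. |\<phi> k 0|\<^sup>2)\<close>
  (\<open>normsq_orthonormal_combination_diff_delta\<close>).  The minimiser \<open>f \<star> p n\<close> therefore has
  \<open>d k = conj (e k 0)\<close>, whence \<open>f 0 * p n 0 = S n\<close>, a real number, and the squared distance of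
  \<open>f \<star> p n\<close> to \<open>1\<close> is \<open>1 - S n\<close> (\<open>optimal_approximant_orthonormal\<close>).  As
  the \<open>\<star>\<close>-inverse of \<open>f\<close> takes the value \<open>inverse (f 0)\<close> at \<open>0\<close>, the second and third
  conditions both say that \<open>S n\<close> tends to \<open>1\<close>.

  So does cyclicity: the distances of \<open>f \<star> p n\<close> to \<open>1\<close> tend to \<open>0\<close> exactly when \<open>1\<close> is
  a limit of polynomial multiples of \<open>f\<close> (\<open>approximable_delta_iff_tendsto\<close>).  The set of these
  limits is closed under sums, shifts and right multiplication by quaternions, so if it contains
  \<open>1\<close> it contains all polynomials and, these being dense, all of \<open>H2\<close>
  (\<open>approximable_of_delta\<close>, \<open>cyclic_iff_approximable\<close>).
\<close>

section \<open>Square-summable coefficient sequences\<close>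

lemma qcnj_zero [simp]: "qcnj 0 = 0"
  and qcnj_eq_0_iff [simp]: "qcnj x = 0 \<longleftrightarrow> x = 0"
  and qcnj_add: "qcnj (x + y) = qcnj x + qcnj y"
  and qcnj_mult: "qcnj (x * y) = qcnj y * qcnj x"
  by (simp_all add: quat_eq_iff)

lemma norm_qcnj [simp]: "norm (qcnj x) = norm x"
  by (simp add: norm_quat_def)

lemma Qre_of_real [simp]: "Qre (of_real r) = r"
  and Qi_of_real [simp]: "Qi (of_real r) = 0"
  and Qj_of_real [simp]: "Qj (of_real r) = 0"
  and Qk_of_real [simp]: "Qk (of_real r) = 0"
  by (simp_all add: of_real_def)

lemma qcnj_sum: "qcnj (\<Sum>k\<in>A. g k) = (\<Sum>k\<in>A. qcnj (g k))"
  by (induction A rule: infinite_finite_induct) (simp_all add: qcnj_add)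

lemma Qre_sum: "Qre (\<Sum>k\<in>A. g k) = (\<Sum>k\<in>A. Qre (g k))"
  by (induction A rule: infinite_finite_induct) simp_all

lemma norm_quat_square: "(norm x)\<^sup>2 = (Qre x)\<^sup>2 + (Qi x)\<^sup>2 + (Qj x)\<^sup>2 + (Qk x)\<^sup>2"
  by (simp add: norm_quat_def)

lemma qcnj_mult_self: "qcnj x * x = of_real ((norm x)\<^sup>2)"
  and mult_qcnj_self: "x * qcnj x = of_real ((norm x)\<^sup>2)"
  unfolding norm_quat_square by (simp_all add: quat_eq_iff power2_eq_square)

lemma norm_diff_qcnj_square:
  "(norm (d - qcnj e))\<^sup>2 = (norm d)\<^sup>2 - 2 * Qre (e * d) + (norm e)\<^sup>2"
  unfolding norm_quat_square by (simp add: power2_eq_square algebra_simps)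

lemma norm_diff_one_square: "(norm (x - 1))\<^sup>2 = (norm x)\<^sup>2 - 2 * Qre x + (1::real)"
  for x :: quat
  unfolding norm_quat_square by (simp add: power2_eq_square algebra_simps)

text \<open>Completeness gives access to the comparison test for series of quaternions.\<close>

instance quat :: banach
proof
  fix X :: "nat \<Rightarrow> quat" assume X: "Cauchy X"
  have bl: "bounded_linear Qre" "bounded_linear Qi" "bounded_linear Qj" "bounded_linear Qk"
    by (auto intro!: bounded_linear_intro[where K = 1] real_le_rsqrt simp: norm_quat_def)
  have "convergent (\<lambda>n. C (X n))" if "bounded_linear C" for C :: "quat \<Rightarrow> real"
    using bounded_linear.Cauchy[OF that X] by (rule Cauchy_convergent)
  from bl[THEN this] obtain r i j k where lims: "(\<lambda>n. Qre (X n)) \<longlonglongrightarrow> r"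
    "(\<lambda>n. Qi (X n)) \<longlonglongrightarrow> i" "(\<lambda>n. Qj (X n)) \<longlonglongrightarrow> j" "(\<lambda>n. Qk (X n)) \<longlonglongrightarrow> k"
    unfolding convergent_def by blast
  have "(\<lambda>n. norm (X n - Quat r i j k)) \<longlonglongrightarrow>
      sqrt ((r - r)\<^sup>2 + (i - i)\<^sup>2 + (j - j)\<^sup>2 + (k - k)\<^sup>2)"
    unfolding norm_quat_def minus_quat.simps quat.sel by (intro tendsto_intros lims)
  then have "(\<lambda>n. norm (X n - Quat r i j k)) \<longlonglongrightarrow> 0"
    by (simp only: diff_self power_zero_numeral add_0_right real_sqrt_zero)
  then have "X \<longlonglongrightarrow> Quat r i j k"
    by (rule LIM_zero_cancel[OF tendsto_norm_zero_cancel])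
  then show "convergent X"
    by (rule convergentI)
qed

lemma norm_add_square_le: "(norm (x + y))\<^sup>2 \<le> 2 * (norm x)\<^sup>2 + 2 * (norm y)\<^sup>2"
  for x y :: "'a::real_normed_vector"
proof -
  have "(norm (x + y))\<^sup>2 \<le> (norm x + norm y)\<^sup>2"
    by (intro power_mono norm_triangle_ineq) simp
  also have "\<dots> \<le> 2 * (norm x)\<^sup>2 + 2 * (norm y)\<^sup>2"
    using sum_squares_bound[of "norm x" "norm y"] by (simp add: power2_sum)
  finally show ?thesis .
qed

text \<open>The coefficient space of \<^const>\<open>H2\<close>.\<close>

definition ell2 :: "(nat \<Rightarrow> quat) set" where
  "ell2 = {a. summable (\<lambda>n. (norm (a n))\<^sup>2)}"

text \<open>The squared norm; it is additive on orthogonal sums, which the norm itself is not.  The value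
  is meaningful only on \<^const>\<open>ell2\<close>.\<close>

definition normsq :: "(nat \<Rightarrow> quat) \<Rightarrow> real" where
  "normsq a = (\<Sum>n. (norm (a n))\<^sup>2)"

text \<open>Right linear in the first argument, conjugate linear in the second, as \<^const>\<open>H2_inner\<close>.\<close>

definition ell2_inner :: "(nat \<Rightarrow> quat) \<Rightarrow> (nat \<Rightarrow> quat) \<Rightarrow> quat" where
  "ell2_inner a b = (\<Sum>n. qcnj (b n) * a n)"

text \<open>Multiplication by \<open>q ^ k\<close> on the coefficient side.\<close>

definition shift :: "nat \<Rightarrow> (nat \<Rightarrow> quat) \<Rightarrow> nat \<Rightarrow> quat" where
  "shift k a m = (if m < k then 0 else a (m - k))"

text \<open>The coefficients of the constant function \<open>1\<close>.\<close>

definition delta :: "nat \<Rightarrow> quat" where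
  "delta m = (if m = 0 then 1 else 0)"

lemma ell2_sums: "a \<in> ell2 \<Longrightarrow> (\<lambda>n. (norm (a n))\<^sup>2) sums normsq a"
  by (simp add: ell2_def normsq_def summable_sums)

lemma normsq_nonneg: "a \<in> ell2 \<Longrightarrow> 0 \<le> normsq a"
  by (simp add: ell2_def normsq_def suminf_nonneg)

lemma ell2_zero: "(\<lambda>m. 0) \<in> ell2"
  by (simp add: ell2_def)

text \<open>The second part replaces the triangle inequality; the factor \<open>2\<close> is harmless for limits.\<close>

lemma ell2_add:
  assumes "a \<in> ell2" "b \<in> ell2"
  shows "(\<lambda>m. a m + b m) \<in> ell2"
    and "normsq (\<lambda>m. a m + b m) \<le> 2 * normsq a + 2 * normsq b"
proof -
  have s: "(\<lambda>m. 2 * (norm (a m))\<^sup>2 + 2 * (norm (b m))\<^sup>2) sums (2 * normsq a + 2 * normsq b)"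
    by (intro sums_add sums_mult ell2_sums assms)
  show m: "(\<lambda>m. a m + b m) \<in> ell2"
    unfolding ell2_def mem_Collect_eq
    by (rule summable_comparison_test[OF _ sums_summable[OF s]])
      (auto intro!: exI[of _ 0] simp: norm_add_square_le)
  show "normsq (\<lambda>m. a m + b m) \<le> 2 * normsq a + 2 * normsq b"
    by (rule sums_le[OF _ ell2_sums[OF m] s]) (simp add: norm_add_square_le)
qed

lemma ell2_mult_right:
  assumes "a \<in> ell2"
  shows "(\<lambda>m. a m * c) \<in> ell2" and "normsq (\<lambda>m. a m * c) = normsq a * (norm c)\<^sup>2"
proof -
  have "(\<lambda>m. (norm (a m * c))\<^sup>2) sums (normsq a * (norm c)\<^sup>2)"
    using sums_mult2[OF ell2_sums[OF assms], of "(norm c)\<^sup>2"]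
    by (simp add: norm_mult power_mult_distrib)
  then show "(\<lambda>m. a m * c) \<in> ell2" "normsq (\<lambda>m. a m * c) = normsq a * (norm c)\<^sup>2"
    by (auto simp: ell2_def normsq_def sums_iff)
qed

lemma ell2_diff:
  assumes "a \<in> ell2" "b \<in> ell2"
  shows "(\<lambda>m. a m - b m) \<in> ell2"
proof -
  have "(\<lambda>m. - b m) \<in> ell2"
    using assms(2) by (simp add: ell2_def)
  from ell2_add(1)[OF assms(1) this] show ?thesis
    by simp
qed

lemma ell2_sum:
  "(\<And>k. k \<in> A \<Longrightarrow> E k \<in> ell2) \<Longrightarrow> (\<lambda>m. \<Sum>k\<in>A. E k m) \<in> ell2"
  by (induction A rule: infinite_finite_induct) (simp_all add: ell2_zero ell2_add(1))

lemma ell2_shift: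
  assumes "a \<in> ell2"
  shows "shift k a \<in> ell2" and "normsq (shift k a) = normsq a"
proof -
  have "(\<lambda>m. (norm (shift k a (m + k)))\<^sup>2) sums normsq a"
    using ell2_sums[OF assms] by (simp add: shift_def)
  then have "(\<lambda>m. (norm (shift k a m))\<^sup>2) sums normsq a"
    by (subst (asm) sums_iff_shift) (simp add: shift_def)
  then show "shift k a \<in> ell2" "normsq (shift k a) = normsq a"
    by (auto simp: ell2_def normsq_def sums_iff)
qed

lemma ell2_finite_support:
  assumes "\<forall>k>n. r k = 0"
  shows "r \<in> ell2"
proof -
  have "summable (\<lambda>m. (norm (r m))\<^sup>2)"
    by (rule summable_finite[of "{..n}"]) (use assms in auto)
  then show ?thesis
    by (simp add: ell2_def)
qed

lemma ell2_delta: "delta \<in> ell2"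
  by (rule ell2_finite_support[of 0]) (simp add: delta_def)

lemma ell2_inner_sums:
  assumes "a \<in> ell2" "b \<in> ell2"
  shows "(\<lambda>n. qcnj (b n) * a n) sums ell2_inner a b"
proof -
  have s: "summable (\<lambda>m. (norm (a m))\<^sup>2 + (norm (b m))\<^sup>2)"
    using assms by (intro summable_add) (auto simp: ell2_def)
  have le: "norm (qcnj (b m) * a m) \<le> (norm (a m))\<^sup>2 + (norm (b m))\<^sup>2" for m
  proof -
    have "0 \<le> norm (b m) * norm (a m)"
      by simp
    then show ?thesis
      unfolding norm_mult norm_qcnj
      using sum_squares_bound[of "norm (b m)" "norm (a m)"] by linarith
  qed
  have "summable (\<lambda>m. qcnj (b m) * a m)"
    by (rule summable_comparison_test[OF _ s]) (use le in auto)
  then show ?thesis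
    by (simp add: ell2_inner_def summable_sums)
qed

lemma normsq_orthonormal_combination:
  fixes n :: nat
  assumes E: "\<And>k. k \<le> n \<Longrightarrow> E k \<in> ell2"
    and on: "\<And>j k. j \<le> n \<Longrightarrow> k \<le> n \<Longrightarrow> ell2_inner (E j) (E k) = (if j = k then 1 else 0)"
  shows "normsq (\<lambda>m. \<Sum>k\<le>n. E k m * d k) = (\<Sum>k\<le>n. (norm (d k))\<^sup>2)"
proof -
  let ?s = "\<lambda>m. \<Sum>k\<le>n. E k m * d k"
  have "(\<lambda>m. \<Sum>j\<le>n. \<Sum>k\<le>n. qcnj (d j) * (qcnj (E j m) * E k m) * d k) sums
      (\<Sum>j\<le>n. \<Sum>k\<le>n. qcnj (d j) * ell2_inner (E k) (E j) * d k)"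
    by (intro sums_sum sums_mult sums_mult2 ell2_inner_sums E) auto
  moreover have "(\<Sum>j\<le>n. \<Sum>k\<le>n. qcnj (d j) * (qcnj (E j m) * E k m) * d k)
      = of_real ((norm (?s m))\<^sup>2)" for m
    unfolding qcnj_mult_self[symmetric] qcnj_sum sum_product qcnj_mult by (simp add: mult.assoc)
  moreover have "(\<Sum>j\<le>n. \<Sum>k\<le>n. qcnj (d j) * ell2_inner (E k) (E j) * d k)
      = of_real (\<Sum>k\<le>n. (norm (d k))\<^sup>2)"
  proof -
    have "(\<Sum>k\<le>n. qcnj (d j) * ell2_inner (E k) (E j) * d k) = of_real ((norm (d j))\<^sup>2)"
      if "j \<le> n" for j
    proof -
      have "(\<Sum>k\<le>n. qcnj (d j) * ell2_inner (E k) (E j) * d k)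
          = (\<Sum>k\<le>n. if k = j then qcnj (d j) * d j else 0)"
        by (rule sum.cong) (use that on in auto)
      also have "\<dots> = of_real ((norm (d j))\<^sup>2)"
        using that by (simp add: qcnj_mult_self del: of_real_power)
      finally show ?thesis .
    qed
    then show ?thesis
      by simp
  qed
  ultimately have
    "(\<lambda>m. of_real ((norm (?s m))\<^sup>2) :: quat) sums of_real (\<Sum>k\<le>n. (norm (d k))\<^sup>2)"
    by simp
  then show ?thesis
    unfolding sums_of_real_iff normsq_def by (rule sums_unique[symmetric])
qed

lemma normsq_diff_delta:
  assumes "s \<in> ell2"
  shows "normsq (\<lambda>m. s m - delta m) = normsq s + (1 - 2 * Qre (s 0))"
proof -
  have "(\<lambda>m. (norm (s m))\<^sup>2 + (if m = 0 then 1 - 2 * Qre (s m) else 0))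
      sums (normsq s + (1 - 2 * Qre (s 0)))"
    by (intro sums_add ell2_sums assms) (rule sums_single)
  moreover have "(norm (s m))\<^sup>2 + (if m = 0 then 1 - 2 * Qre (s m) else 0)
      = (norm (s m - delta m))\<^sup>2" for m
    by (simp add: delta_def norm_diff_one_square)
  ultimately show ?thesis
    by (simp add: normsq_def sums_iff)
qed

text \<open>
  Completing the square: the inner product of \<^const>\<open>delta\<close> with \<open>E k\<close> is \<open>qcnj (E k 0)\<close>, so the
  combination with these coefficients is the closest to \<^const>\<open>delta\<close>, and the distance is given
  by Bessel's identity.
\<close>

lemma normsq_orthonormal_combination_diff_delta:
  fixes n :: nat
  assumes E: "\<And>k. k \<le> n \<Longrightarrow> E k \<in> ell2"
    and on: "\<And>j k. j \<le> n \<Longrightarrow> k \<le> n \<Longrightarrow> ell2_inner (E j) (E k) = (if j = k then 1 else 0)"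
  shows "normsq (\<lambda>m. (\<Sum>k\<le>n. E k m * d k) - delta m) =
    1 - (\<Sum>k\<le>n. (norm (E k 0))\<^sup>2) + (\<Sum>k\<le>n. (norm (d k - qcnj (E k 0)))\<^sup>2)"
proof -
  have "(\<lambda>m. \<Sum>k\<le>n. E k m * d k) \<in> ell2"
    by (intro ell2_sum ell2_mult_right(1) E) simp
  from normsq_diff_delta[OF this] show ?thesis
    by (simp add: normsq_orthonormal_combination[OF E on] norm_diff_qcnj_square Qre_sum
        sum.distrib sum_subtractf sum_distrib_left del: times_quat.simps)
qed


section \<open>Convolution and approximation\<close>

text \<open>The coefficients of a \<open>\<star>\<close>-product.\<close>

definition conv :: "(nat \<Rightarrow> quat) \<Rightarrow> (nat \<Rightarrow> quat) \<Rightarrow> nat \<Rightarrow> quat" where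
  "conv a b m = (\<Sum>k\<le>m. a k * b (m - k))"

text \<open>The coefficient sequences of \<open>f \<star> r\<close>, where \<open>f\<close> has coefficients \<open>a\<close> and \<open>r\<close> ranges over
  all polynomials.\<close>

definition poly_multiples :: "(nat \<Rightarrow> quat) \<Rightarrow> (nat \<Rightarrow> quat) set" where
  "poly_multiples a = {conv a r | r. \<exists>n. \<forall>k>n. r k = 0}"

text \<open>Membership in the closure of \<open>S\<close>, for \<open>S\<close> and \<open>u\<close> in \<^const>\<open>ell2\<close>.\<close>

definition approximable :: "(nat \<Rightarrow> quat) set \<Rightarrow> (nat \<Rightarrow> quat) \<Rightarrow> bool" where
  "approximable S u \<longleftrightarrow> (\<forall>\<epsilon>>0. \<exists>w\<in>S. normsq (\<lambda>m. w m - u m) < \<epsilon>)"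

lemma conv_0 [simp]: "conv a b 0 = a 0 * b 0"
  by (simp add: conv_def)

lemma conv_add: "conv a (\<lambda>m. b m + c m) = (\<lambda>m. conv a b m + conv a c m)"
  by (simp add: conv_def fun_eq_iff distrib_left sum.distrib)

lemma conv_mult_right: "conv a (\<lambda>m. b m * c) = (\<lambda>m. conv a b m * c)"
  by (simp add: conv_def fun_eq_iff sum_distrib_right mult.assoc)

lemma conv_sum: "conv a (\<lambda>m. \<Sum>i\<in>A. b i m) = (\<lambda>m. \<Sum>i\<in>A. conv a (b i) m)"
  unfolding conv_def sum_distrib_left by (rule ext, rule sum.swap)

lemma conv_shift: "conv a (shift j r) = shift j (conv a r)"
proof
  fix m
  show "conv a (shift j r) m = shift j (conv a r) m"
  proof (cases "m < j")
    case True
    then show ?thesis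
      by (auto simp: conv_def shift_def intro!: sum.neutral)
  next
    case False
    have "(\<Sum>k\<le>m. a k * shift j r (m - k)) = (\<Sum>k\<le>m - j. a k * r (m - j - k))"
      by (rule sum.mono_neutral_cong_right)
        (use False in \<open>auto simp: shift_def algebra_simps\<close>)
    with False show ?thesis
      by (simp add: conv_def shift_def)
  qed
qed

lemma conv_finite_support:
  assumes "\<forall>k>n. r k = 0"
  shows "conv a r m = (\<Sum>k\<le>n. shift k a m * r k)"
proof -
  have "conv a r m = (\<Sum>k\<le>m. a (m - k) * r k)"
    unfolding conv_def by (rule sum.reindex_bij_witness[of _ "\<lambda>k. m - k" "\<lambda>k. m - k"]) auto
  also have "\<dots> = (\<Sum>k\<le>max m n. shift k a m * r k)"
    by (rule sum.mono_neutral_cong_left) (auto simp: shift_def)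
  also have "\<dots> = (\<Sum>k\<le>n. shift k a m * r k)"
    by (rule sum.mono_neutral_right) (use assms in auto)
  finally show ?thesis .
qed

lemma conv_ell2:
  assumes "a \<in> ell2" "\<forall>k>n. r k = 0"
  shows "conv a r \<in> ell2"
  unfolding conv_finite_support[OF assms(2), abs_def]
  by (intro ell2_sum ell2_mult_right(1) ell2_shift(1) assms(1))

lemma poly_multiples_ell2: "a \<in> ell2 \<Longrightarrow> w \<in> poly_multiples a \<Longrightarrow> w \<in> ell2"
  by (auto simp: poly_multiples_def intro: conv_ell2)

lemma poly_multiples_zero: "(\<lambda>m. 0) \<in> poly_multiples a"
proof -
  have "conv a (\<lambda>m. 0) = (\<lambda>m. 0)"
    by (simp add: conv_def fun_eq_iff)
  then show ?thesis
    unfolding poly_multiples_def by (intro CollectI exI[of _ "\<lambda>m. 0"]) auto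
qed

lemma poly_multiples_add:
  assumes "v \<in> poly_multiples a" "w \<in> poly_multiples a"
  shows "(\<lambda>m. v m + w m) \<in> poly_multiples a"
proof -
  obtain r n s l where "v = conv a r" "\<forall>k>n. r k = 0" "w = conv a s" "\<forall>k>l. s k = 0"
    using assms by (auto simp: poly_multiples_def)
  then show ?thesis
    unfolding poly_multiples_def
    by (intro CollectI exI[of _ "\<lambda>m. r m + s m"] conjI exI[of _ "max n l"])
      (simp_all add: conv_add)
qed

lemma poly_multiples_shift_mult:
  assumes "w \<in> poly_multiples a"
  shows "(\<lambda>m. shift j w m * c) \<in> poly_multiples a"
proof -
  obtain r n where "w = conv a r" "\<forall>k>n. r k = 0"
    using assms by (auto simp: poly_multiples_def)
  then have "(\<lambda>m. shift j w m * c) = conv a (\<lambda>m. shift j r m * c)"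
    and "\<forall>k>n + j. shift j r k * c = 0"
    by (simp_all only: conv_mult_right conv_shift) (simp add: shift_def)
  then show ?thesis
    unfolding poly_multiples_def by blast
qed

lemma approximableD:
  "approximable S u \<Longrightarrow> \<epsilon> > 0 \<Longrightarrow> \<exists>w\<in>S. normsq (\<lambda>m. w m - u m) < \<epsilon>"
  by (simp add: approximable_def)

lemma approximable_add:
  assumes S: "S \<subseteq> ell2" "\<And>v w. v \<in> S \<Longrightarrow> w \<in> S \<Longrightarrow> (\<lambda>m. v m + w m) \<in> S"
    and uv: "u \<in> ell2" "v \<in> ell2" "approximable S u" "approximable S v"
  shows "approximable S (\<lambda>m. u m + v m)"
  unfolding approximable_def
proof (intro allI impI)
  fix \<epsilon> :: real assume "\<epsilon> > 0"
  then have "\<epsilon> / 4 > 0" by simp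
  then obtain w z where w: "w \<in> S" "normsq (\<lambda>m. w m - u m) < \<epsilon> / 4"
    and z: "z \<in> S" "normsq (\<lambda>m. z m - v m) < \<epsilon> / 4"
    using approximableD[OF uv(3)] approximableD[OF uv(4)] by meson
  have "normsq (\<lambda>m. (w m - u m) + (z m - v m))
      \<le> 2 * normsq (\<lambda>m. w m - u m) + 2 * normsq (\<lambda>m. z m - v m)"
    by (intro ell2_add(2) ell2_diff uv(1,2) subsetD[OF S(1) w(1)] subsetD[OF S(1) z(1)])
  also have "(\<lambda>m. (w m - u m) + (z m - v m)) = (\<lambda>m. (w m + z m) - (u m + v m))"
    by (simp add: algebra_simps)
  also have "2 * normsq (\<lambda>m. w m - u m) + 2 * normsq (\<lambda>m. z m - v m) < \<epsilon>"
    using w(2) z(2) by simp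
  finally show "\<exists>w\<in>S. normsq (\<lambda>m. w m - (u m + v m)) < \<epsilon>"
    using S(2)[OF w(1) z(1)] by (rule bexI[where P = "\<lambda>w. normsq (\<lambda>m. w m - (u m + v m)) < \<epsilon>"])
qed

lemma approximable_shift_mult:
  assumes S: "S \<subseteq> ell2" "\<And>w. w \<in> S \<Longrightarrow> (\<lambda>m. shift j w m * c) \<in> S"
    and u: "u \<in> ell2" "approximable S u"
  shows "approximable S (\<lambda>m. shift j u m * c)"
  unfolding approximable_def
proof (intro allI impI)
  fix \<epsilon> :: real assume \<epsilon>: "\<epsilon> > 0"
  \<comment> \<open>The summand 1 keeps the tolerance positive and well defined for \<open>c = 0\<close>.\<close>
  have pos: "(norm c)\<^sup>2 + 1 > 0"
    by (simp add: add_nonneg_pos)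
  with \<epsilon> obtain w where w: "w \<in> S" "normsq (\<lambda>m. w m - u m) < \<epsilon> / ((norm c)\<^sup>2 + 1)"
    using approximableD[OF u(2) divide_pos_pos] by meson
  have d: "(\<lambda>m. w m - u m) \<in> ell2"
    by (intro ell2_diff u(1) subsetD[OF S(1) w(1)])
  have "(\<lambda>m. shift j w m * c - shift j u m * c) = (\<lambda>m. shift j (\<lambda>m. w m - u m) m * c)"
    by (auto simp: shift_def fun_eq_iff left_diff_distrib)
  then have "normsq (\<lambda>m. shift j w m * c - shift j u m * c)
      = normsq (\<lambda>m. w m - u m) * (norm c)\<^sup>2"
    using ell2_mult_right(2)[OF ell2_shift(1)[OF d]] ell2_shift(2)[OF d] by simp
  also have "\<dots> \<le> normsq (\<lambda>m. w m - u m) * ((norm c)\<^sup>2 + 1)"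
    using normsq_nonneg[OF d] by (intro mult_left_mono) auto
  also have "\<dots> < \<epsilon>"
    using w(2) pos by (simp add: pos_less_divide_eq)
  finally show "\<exists>w\<in>S. normsq (\<lambda>m. w m - shift j u m * c) < \<epsilon>"
    using S(2)[OF w(1)] by (intro bexI[of _ "\<lambda>m. shift j w m * c"])
qed

lemma approximable_limit:
  assumes S: "S \<subseteq> ell2" and u: "u \<in> ell2" and v: "\<And>n. v n \<in> ell2" "\<And>n. approximable S (v n)"
    and lim: "(\<lambda>n. normsq (\<lambda>m. v n m - u m)) \<longlonglongrightarrow> 0"
  shows "approximable S u"
  unfolding approximable_def
proof (intro allI impI)
  fix \<epsilon> :: real assume "\<epsilon> > 0"
  then have \<epsilon>: "\<epsilon> / 4 > 0" by simp
  have "eventually (\<lambda>n. normsq (\<lambda>m. v n m - u m) < \<epsilon> / 4) sequentially"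
    using order_tendstoD(2)[OF lim \<epsilon>] .
  then obtain n where n: "normsq (\<lambda>m. v n m - u m) < \<epsilon> / 4"
    using eventually_happens'[OF sequentially_bot] by blast
  obtain w where w: "w \<in> S" "normsq (\<lambda>m. w m - v n m) < \<epsilon> / 4"
    using approximableD[OF v(2) \<epsilon>] by meson
  have "normsq (\<lambda>m. (w m - v n m) + (v n m - u m))
      \<le> 2 * normsq (\<lambda>m. w m - v n m) + 2 * normsq (\<lambda>m. v n m - u m)"
    by (intro ell2_add(2) ell2_diff u v(1) subsetD[OF S w(1)])
  also have "(\<lambda>m. (w m - v n m) + (v n m - u m)) = (\<lambda>m. w m - u m)"
    by simp
  also have "2 * normsq (\<lambda>m. w m - v n m) + 2 * normsq (\<lambda>m. v n m - u m) < \<epsilon>"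
    using w(2) n by simp
  finally show "\<exists>w\<in>S. normsq (\<lambda>m. w m - u m) < \<epsilon>"
    using w(1) by (rule bexI)
qed

lemma normsq_truncation_tendsto_0:
  assumes "u \<in> ell2"
  shows "(\<lambda>n. normsq (\<lambda>m. (if m \<le> n then u m else 0) - u m)) \<longlonglongrightarrow> 0"
proof -
  let ?t = "\<lambda>n m. (if m \<le> n then u m else 0) - u m"
  have tail: "normsq (?t n) = normsq u - (\<Sum>k\<le>n. (norm (u k))\<^sup>2)" for n
  proof -
    have "(\<lambda>m. (norm (u m))\<^sup>2 - (if m \<in> {..n} then (norm (u m))\<^sup>2 else 0)) sums
        (normsq u - (\<Sum>k\<in>{..n}. (norm (u k))\<^sup>2))"
      by (intro sums_diff ell2_sums assms sums_If_finite_set) simp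
    also have "(\<lambda>m. (norm (u m))\<^sup>2 - (if m \<in> {..n} then (norm (u m))\<^sup>2 else 0))
        = (\<lambda>m. (norm (?t n m))\<^sup>2)"
      by (rule ext) auto
    finally show ?thesis
      unfolding normsq_def[of "?t n"] by (rule sums_unique[symmetric])
  qed
  have "(\<lambda>n. \<Sum>k\<le>n. (norm (u k))\<^sup>2) \<longlonglongrightarrow> normsq u"
    using ell2_sums[OF assms] unfolding sums_def_le .
  from tendsto_diff[OF tendsto_const this, of "normsq u"] show ?thesis
    unfolding tail by simp
qed

text \<open>If the constant \<open>1\<close> is a limit of polynomial multiples of \<open>f\<close>, then so is every element of the
  Hardy space.\<close>

lemma approximable_of_delta:
  assumes a: "a \<in> ell2" and delta: "approximable (poly_multiples a) delta" and u: "u \<in> ell2"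
  shows "approximable (poly_multiples a) u"
proof -
  \<comment> \<open>The truncations \<open>v n\<close> of \<open>u\<close> are sums of the monomials \<open>t j\<close>.\<close>
  define v where "v n m = (if m \<le> n then u m else 0)" for n m
  define t where "t j m = shift j delta m * u j" for j m
  have P: "poly_multiples a \<subseteq> ell2"
    using a poly_multiples_ell2 by blast
  have v: "v n \<in> ell2" for n
    by (rule ell2_finite_support[of n]) (simp add: v_def)
  have t: "t j \<in> ell2" for j
    unfolding t_def[abs_def] by (intro ell2_mult_right(1) ell2_shift(1) ell2_delta)
  have t': "approximable (poly_multiples a) (t j)" for j
    unfolding t_def[abs_def]
    by (rule approximable_shift_mult[OF P _ ell2_delta delta]) (rule poly_multiples_shift_mult)
  have v': "approximable (poly_multiples a) (v n)" for n
  proof (induction n)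
    case 0
    have "v 0 = t 0"
      by (auto simp: v_def t_def shift_def delta_def fun_eq_iff)
    then show ?case
      using t' by simp
  next
    case (Suc n)
    have "approximable (poly_multiples a) (\<lambda>m. v n m + t (Suc n) m)"
      by (rule approximable_add[OF P poly_multiples_add v t Suc t'])
    moreover have "v (Suc n) = (\<lambda>m. v n m + t (Suc n) m)"
      by (auto simp: v_def t_def shift_def delta_def fun_eq_iff le_Suc_eq)
    ultimately show ?case
      by simp
  qed
  have "(\<lambda>n. normsq (\<lambda>m. v n m - u m)) \<longlonglongrightarrow> 0"
    unfolding v_def by (rule normsq_truncation_tendsto_0[OF u])
  from approximable_limit[OF P u v v' this] show ?thesis .
qed


section \<open>Power series and their coefficients\<close>

lemma sums_power_zero: "(\<lambda>n. 0 ^ n * c n) sums (c 0 :: quat)"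
proof -
  have "(\<lambda>n. 0 ^ n * c n) = (\<lambda>n. if n = 0 then c n else 0)"
    by (auto simp: power_0_left)
  then show ?thesis
    using sums_single[of 0 c] by simp
qed

lemma suminf_power_zero: "(\<Sum>n. 0 ^ n * c n) = (c 0 :: quat)"
  using sums_unique[OF sums_power_zero[of c]] by simp

lemma has_ps_coeffs_zero: "has_ps_coeffs f a \<Longrightarrow> f 0 = a 0"
  unfolding has_ps_coeffs_def using sums_unique2[OF _ sums_power_zero[of a]] by force

lemma has_ps_coeffs_cong:
  "has_ps_coeffs f a \<Longrightarrow> (\<And>q. q \<in> ball 0 1 \<Longrightarrow> g q = f q) \<Longrightarrow> has_ps_coeffs g a"
  by (simp add: has_ps_coeffs_def)

lemma has_ps_coeffs_diff:
  "has_ps_coeffs f a \<Longrightarrow> has_ps_coeffs g b \<Longrightarrow> has_ps_coeffs (\<lambda>q. f q - g q) (\<lambda>m. a m - b m)"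
  unfolding has_ps_coeffs_def right_diff_distrib by (auto intro: sums_diff)

lemma has_ps_coeffs_mult_right:
  "has_ps_coeffs f a \<Longrightarrow> has_ps_coeffs (\<lambda>q. f q * c) (\<lambda>m. a m * c)"
  unfolding has_ps_coeffs_def mult.assoc[symmetric] by (auto intro: sums_mult2)

lemma has_ps_coeffs_sum:
  "(\<And>k. k \<in> A \<Longrightarrow> has_ps_coeffs (f k) (a k)) \<Longrightarrow>
    has_ps_coeffs (\<lambda>q. \<Sum>k\<in>A. f k q) (\<lambda>m. \<Sum>k\<in>A. a k m)"
  unfolding has_ps_coeffs_def sum_distrib_left by (auto intro!: sums_sum)

lemma has_ps_coeffs_finite:
  assumes "\<forall>k>n. a k = 0"
  shows "has_ps_coeffs (\<lambda>q. \<Sum>k\<le>n. q ^ k * a k) a"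
  unfolding has_ps_coeffs_def
proof
  show "(\<lambda>k. q ^ k * a k) sums (\<Sum>k\<le>n. q ^ k * a k)" for q
    by (rule sums_finite) (simp_all add: assms not_le)
qed

lemma has_ps_coeffs_one: "has_ps_coeffs (\<lambda>q. 1) delta"
  using has_ps_coeffs_finite[of 0 delta] by (simp add: delta_def)

lemma has_ps_coeffs_power: "has_ps_coeffs (\<lambda>q. q ^ n) (shift n delta)"
proof -
  have "has_ps_coeffs (\<lambda>q. \<Sum>k\<le>n. q ^ k * shift n delta k) (shift n delta)"
    by (rule has_ps_coeffs_finite) (simp add: shift_def delta_def)
  moreover have "(\<Sum>k\<le>n. q ^ k * shift n delta k) = q ^ n" for q
  proof -
    have "(\<Sum>k\<le>n. q ^ k * shift n delta k) = (\<Sum>k\<le>n. if k = n then q ^ n else 0)"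
      by (rule sum.cong) (auto simp: shift_def delta_def)
    then show ?thesis by simp
  qed
  ultimately show ?thesis by simp
qed

lemma has_ps_coeffs_ell2:
  assumes "a \<in> ell2"
  shows "has_ps_coeffs (\<lambda>q. \<Sum>n. q ^ n * a n) a"
  unfolding has_ps_coeffs_def
proof
  fix q :: quat assume "q \<in> ball 0 1"
  then have q: "norm q < 1" by simp
  have "(\<lambda>n. (norm (a n))\<^sup>2) \<longlonglongrightarrow> 0"
    by (rule summable_LIMSEQ_zero) (use assms in \<open>simp add: ell2_def\<close>)
  then have "a \<longlonglongrightarrow> 0"
    by (simp add: tendsto_norm_zero_iff)
  then have "Bseq a"
    by (rule convergent_imp_Bseq[OF convergentI])
  then obtain K where K: "\<And>n. norm (a n) \<le> K"
    unfolding Bseq_def by auto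
  have "summable (\<lambda>n. norm q ^ n * K)"
    using q by (intro summable_mult2 summable_geometric) simp
  then have "summable (\<lambda>n. q ^ n * a n)"
    by (rule summable_comparison_test[rotated])
      (auto intro!: exI[of _ 0] mult_left_mono K simp: norm_mult norm_power)
  then show "(\<lambda>n. q ^ n * a n) sums (\<Sum>n. q ^ n * a n)"
    by (rule summable_sums)
qed

lemma H2_iff: "f \<in> H2 \<longleftrightarrow> has_ps_coeffs f (ps_coeffs f) \<and> ps_coeffs f \<in> ell2"
  by (auto simp: H2_def ell2_def ps_coeffs_eqI)

lemma H2_norm_eq: "has_ps_coeffs f a \<Longrightarrow> H2_norm f = sqrt (normsq a)"
  by (simp add: H2_norm_def normsq_def ps_coeffs_eqI)

lemma star_coeffs:
  assumes "has_ps_coeffs f a" "has_ps_coeffs g b" "conv a b \<in> ell2"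
  shows "has_ps_coeffs (f \<star> g) (conv a b)"
  using has_ps_coeffs_ell2[OF assms(3)]
  by (simp add: star_def ps_coeffs_eqI[OF assms(1)] ps_coeffs_eqI[OF assms(2)] conv_def)

lemma conv_shift_delta: "conv (shift n delta) a = shift n a"
proof
  fix m
  have "conv (shift n delta) a m = (\<Sum>k\<le>m. if k = n then a (m - n) else 0)"
    unfolding conv_def by (rule sum.cong) (auto simp: shift_def delta_def)
  also have "\<dots> = shift n a m"
    by (simp add: shift_def not_le[symmetric])
  finally show "conv (shift n delta) a m = shift n a m" .
qed

lemma power_star_coeffs:
  assumes "has_ps_coeffs f a" "a \<in> ell2"
  shows "has_ps_coeffs ((\<lambda>q. q ^ n) \<star> f) (shift n a)"
  using star_coeffs[OF has_ps_coeffs_power assms(1)] by (simp add: conv_shift_delta ell2_shift assms)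

lemma polys_coeffs:
  assumes "r \<in> polys n"
  shows "has_ps_coeffs r (ps_coeffs r)" "\<forall>k>n. ps_coeffs r k = 0"
proof -
  obtain c where r: "r = (\<lambda>q. \<Sum>k\<le>n. q ^ k * c k)"
    using assms by (auto simp: polys_def)
  have "has_ps_coeffs r (\<lambda>k. if k \<le> n then c k else 0)"
    using has_ps_coeffs_finite[of n "\<lambda>k. if k \<le> n then c k else 0"] by (simp add: r)
  then show "has_ps_coeffs r (ps_coeffs r)" "\<forall>k>n. ps_coeffs r k = 0"
    by (auto simp: ps_coeffs_eqI)
qed

lemma finite_support_polys:
  assumes "\<forall>k>n. b k = 0"
  obtains r where "r \<in> polys n" "has_ps_coeffs r b" "ps_coeffs r = b"
proof
  show "(\<lambda>q. \<Sum>k\<le>n. q ^ k * b k) \<in> polys n"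
    by (auto simp: polys_def)
  show "has_ps_coeffs (\<lambda>q. \<Sum>k\<le>n. q ^ k * b k) b"
    by (rule has_ps_coeffs_finite[OF assms])
  then show "ps_coeffs (\<lambda>q. \<Sum>k\<le>n. q ^ k * b k) = b"
    by (rule ps_coeffs_eqI)
qed

lemma star_poly_coeffs:
  assumes "f \<in> H2" "r \<in> polys n"
  shows "has_ps_coeffs (f \<star> r) (conv (ps_coeffs f) (ps_coeffs r))"
    and "conv (ps_coeffs f) (ps_coeffs r) \<in> ell2"
proof -
  have f: "has_ps_coeffs f (ps_coeffs f)" "ps_coeffs f \<in> ell2"
    using assms(1) by (simp_all add: H2_iff)
  show *: "conv (ps_coeffs f) (ps_coeffs r) \<in> ell2"
    by (rule conv_ell2[OF f(2) polys_coeffs(2)[OF assms(2)]])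
  show "has_ps_coeffs (f \<star> r) (conv (ps_coeffs f) (ps_coeffs r))"
    by (rule star_coeffs[OF f(1) polys_coeffs(1)[OF assms(2)] *])
qed

lemma star_inverse_zero:
  assumes "f \<in> H2" "f 0 \<noteq> 0"
  shows "star_inverse f 0 = inverse (f 0)"
proof -
  let ?a = "ps_coeffs f"
  have a: "has_ps_coeffs f ?a" "?a \<in> ell2"
    using assms by (auto simp: H2_iff)
  have "(\<lambda>n. qcnj (?a n)) \<in> ell2"
    using a by (simp add: ell2_def)
  then have c: "has_ps_coeffs (regular_conj f) (\<lambda>n. qcnj (?a n))"
    unfolding regular_conj_def by (rule has_ps_coeffs_ell2)
  have "symmetrization f 0 = ?a 0 * qcnj (?a 0)"
    unfolding symmetrization_def star_def ps_coeffs_eqI[OF c] suminf_power_zero by simp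
  then have "symmetrization f 0 = qcnj (?a 0) * ?a 0"
    by (simp only: qcnj_mult_self mult_qcnj_self)
  moreover have "regular_conj f 0 = qcnj (?a 0)"
    using has_ps_coeffs_zero[OF c] .
  moreover have "f 0 = ?a 0"
    using has_ps_coeffs_zero[OF a(1)] .
  ultimately show ?thesis
    using assms(2) by (simp add: star_inverse_def nonzero_inverse_mult_distrib mult.assoc)
qed

text \<open>The span of a family may be written with coefficients attached to the indices rather than to
  the functions, whether or not the family is injective.\<close>

lemma right_span_image_iff:
  "h \<in> right_span (e ` I) \<longleftrightarrow>
    (\<exists>J d. finite J \<and> J \<subseteq> I \<and> (\<forall>q\<in>ball 0 1. h q = (\<Sum>k\<in>J. e k q * d k)))"
proof
  assume "h \<in> right_span (e ` I)"
  then obtain F c where F: "finite F" "F \<subseteq> e ` I" "\<forall>q\<in>ball 0 1. h q = (\<Sum>g\<in>F. g q * c g)"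
    by (auto simp: right_span_def)
  obtain J where J: "J \<subseteq> I" "inj_on e J" "F = e ` J"
    using F(2) by (metis subset_image_inj)
  then have "finite J"
    using F(1) finite_imageD by blast
  moreover have "\<forall>q\<in>ball 0 1. h q = (\<Sum>k\<in>J. e k q * c (e k))"
    using F(3) J by (simp add: sum.reindex)
  ultimately show "\<exists>J d. finite J \<and> J \<subseteq> I \<and> (\<forall>q\<in>ball 0 1. h q = (\<Sum>k\<in>J. e k q * d k))"
    using J(1) by (intro exI[of _ J] exI[of _ "\<lambda>k. c (e k)"] conjI)
next
  assume "\<exists>J d. finite J \<and> J \<subseteq> I \<and> (\<forall>q\<in>ball 0 1. h q = (\<Sum>k\<in>J. e k q * d k))"
  then obtain J d where J: "finite J" "J \<subseteq> I" "\<forall>q\<in>ball 0 1. h q = (\<Sum>k\<in>J. e k q * d k)"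
    by blast
  have "h q = (\<Sum>g\<in>e ` J. g q * (\<Sum>k | k \<in> J \<and> e k = g. d k))" if "q \<in> ball 0 1" for q
  proof -
    have "h q = (\<Sum>g\<in>e ` J. \<Sum>k | k \<in> J \<and> e k = g. e k q * d k)"
      using J(3) that sum.image_gen[OF J(1), of "\<lambda>k. e k q * d k" e] by simp
    then show ?thesis
      by (simp add: sum_distrib_left)
  qed
  with J show "h \<in> right_span (e ` I)"
    unfolding right_span_def
    by (intro CollectI exI[of _ "e ` J"] exI[of _ "\<lambda>g. \<Sum>k | k \<in> J \<and> e k = g. d k"]) auto
qed

lemma right_span_power_star:
  assumes f: "has_ps_coeffs f a" "a \<in> ell2"
  shows "h \<in> right_span (range (\<lambda>n. (\<lambda>q. q ^ n) \<star> f)) \<longleftrightarrow> (\<exists>w\<in>poly_multiples a. has_ps_coeffs h w)"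
proof
  assume "h \<in> right_span (range (\<lambda>n. (\<lambda>q. q ^ n) \<star> f))"
  then obtain J d where J: "finite J" and h: "\<forall>q\<in>ball 0 1. h q = (\<Sum>k\<in>J. ((\<lambda>q. q ^ k) \<star> f) q * d k)"
    unfolding right_span_image_iff by blast
  have "has_ps_coeffs (\<lambda>q. \<Sum>k\<in>J. ((\<lambda>q. q ^ k) \<star> f) q * d k) (\<lambda>m. \<Sum>k\<in>J. shift k a m * d k)"
    by (intro has_ps_coeffs_sum has_ps_coeffs_mult_right power_star_coeffs f)
  then have "has_ps_coeffs h (\<lambda>m. \<Sum>k\<in>J. shift k a m * d k)"
    by (rule has_ps_coeffs_cong) (use h in auto)
  moreover have "conv a delta = a"
    by (rule ext) (use conv_finite_support[of 0 delta a] in \<open>simp add: delta_def shift_def\<close>)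
  then have aP: "a \<in> poly_multiples a"
    unfolding poly_multiples_def
    by (intro CollectI exI[of _ delta]) (auto simp: delta_def)
  have "(\<lambda>m. \<Sum>k\<in>J. shift k a m * d k) \<in> poly_multiples a"
    using J by (induction J rule: finite_induct)
      (simp_all add: poly_multiples_zero poly_multiples_add poly_multiples_shift_mult aP)
  ultimately show "\<exists>w\<in>poly_multiples a. has_ps_coeffs h w"
    by blast
next
  assume "\<exists>w\<in>poly_multiples a. has_ps_coeffs h w"
  then obtain r n where h: "has_ps_coeffs h (conv a r)" and r: "\<forall>k>n. r k = 0"
    by (auto simp: poly_multiples_def)
  have h': "has_ps_coeffs (\<lambda>q. \<Sum>k\<le>n. ((\<lambda>q. q ^ k) \<star> f) q * r k) (conv a r)"
    unfolding conv_finite_support[OF r, abs_def]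
    by (intro has_ps_coeffs_sum has_ps_coeffs_mult_right power_star_coeffs f)
  have "h q = (\<Sum>k\<le>n. ((\<lambda>q. q ^ k) \<star> f) q * r k)" if "q \<in> ball 0 1" for q
    using h h' that unfolding has_ps_coeffs_def by (metis (no_types, lifting) sums_unique2)
  then show "h \<in> right_span (range (\<lambda>n. (\<lambda>q. q ^ n) \<star> f))"
    unfolding right_span_image_iff by (intro exI[of _ "{..n}"] exI[of _ r]) auto
qed

lemma cyclic_iff_approximable:
  assumes "f \<in> H2"
  shows "cyclic f \<longleftrightarrow> approximable (poly_multiples (ps_coeffs f)) delta"
proof -
  let ?a = "ps_coeffs f" and ?V = "right_span (range (\<lambda>n. (\<lambda>q. q ^ n) \<star> f))"
  have f: "has_ps_coeffs f ?a" "?a \<in> ell2"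
    using assms by (auto simp: H2_iff)
  show ?thesis
  proof
    assume "cyclic f"
    moreover have "(\<lambda>q. 1) \<in> H2"
      using has_ps_coeffs_one ell2_delta by (simp add: H2_iff ps_coeffs_eqI)
    ultimately have one: "(\<lambda>q. 1) \<in> H2_closure ?V"
      by (simp add: cyclic_def)
    show "approximable (poly_multiples ?a) delta"
      unfolding approximable_def
    proof (intro allI impI)
      fix \<epsilon> :: real assume "\<epsilon> > 0"
      then have "sqrt \<epsilon> > 0" by simp
      then obtain h where h: "h \<in> ?V" "H2_norm (\<lambda>q. h q - 1) < sqrt \<epsilon>"
        using one unfolding H2_closure_def by blast
      then obtain w where w: "w \<in> poly_multiples ?a" "has_ps_coeffs h w"
        using right_span_power_star[OF f] by blast
      have "normsq (\<lambda>m. w m - delta m) < \<epsilon>"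
        using h(2) H2_norm_eq[OF has_ps_coeffs_diff[OF w(2) has_ps_coeffs_one]] by simp
      with w show "\<exists>w\<in>poly_multiples ?a. normsq (\<lambda>m. w m - delta m) < \<epsilon>"
        by blast
    qed
  next
    assume delta: "approximable (poly_multiples ?a) delta"
    have "g \<in> H2_closure ?V" if g: "g \<in> H2" for g
    proof -
      have g': "has_ps_coeffs g (ps_coeffs g)" "ps_coeffs g \<in> ell2"
        using g by (auto simp: H2_iff)
      have "\<exists>h\<in>?V. H2_norm (\<lambda>q. h q - g q) < \<epsilon>" if "\<epsilon> > 0" for \<epsilon>
      proof -
        obtain w where w: "w \<in> poly_multiples ?a" "normsq (\<lambda>m. w m - ps_coeffs g m) < \<epsilon>\<^sup>2"
          using approximable_of_delta[OF f(2) delta g'(2)] \<open>\<epsilon> > 0\<close>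
          unfolding approximable_def by (meson zero_less_power)
        define h where "h = (\<lambda>q. \<Sum>n. q ^ n * w n)"
        have h: "has_ps_coeffs h w"
          unfolding h_def using has_ps_coeffs_ell2 poly_multiples_ell2[OF f(2) w(1)] .
        then have "h \<in> ?V"
          using right_span_power_star[OF f] w(1) by blast
        moreover have "H2_norm (\<lambda>q. h q - g q) < \<epsilon>"
          unfolding H2_norm_eq[OF has_ps_coeffs_diff[OF h g'(1)]]
          using w(2) \<open>\<epsilon> > 0\<close> by (intro real_less_lsqrt) auto
        ultimately show ?thesis by blast
      qed
      with g show ?thesis
        by (simp add: H2_closure_def)
    qed
    then show "cyclic f"
      using assms by (auto simp: cyclic_def H2_closure_def)
  qed
qed


section \<open>Optimal approximants and cyclicity\<close>

lemma optimal_approximant_normsq_le: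
  assumes f: "f \<in> H2" and p: "optimal_approximant f n p" and r: "\<forall>k>n. r k = 0"
  shows "normsq (\<lambda>m. conv (ps_coeffs f) (ps_coeffs p) m - delta m)
    \<le> normsq (\<lambda>m. conv (ps_coeffs f) r m - delta m)"
proof -
  obtain g where g: "g \<in> polys n" "ps_coeffs g = r"
    using finite_support_polys[OF r] .
  have norm_eq: "H2_norm (\<lambda>q. (f \<star> s) q - 1)
      = sqrt (normsq (\<lambda>m. conv (ps_coeffs f) (ps_coeffs s) m - delta m))" if "s \<in> polys n" for s
    by (rule H2_norm_eq[OF has_ps_coeffs_diff[OF star_poly_coeffs(1)[OF f that] has_ps_coeffs_one]])
  have "p \<in> polys n" "H2_norm (\<lambda>q. (f \<star> p) q - 1) \<le> H2_norm (\<lambda>q. (f \<star> g) q - 1)"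
    using p g(1) by (simp_all add: optimal_approximant_def)
  then show ?thesis
    by (simp add: norm_eq g)
qed

text \<open>
  With \<open>S\<close> the squared length of the orthogonal projection of \<open>1\<close> onto \<open>f \<star> polys n\<close>, both the
  value of the optimal approximant at \<open>0\<close> and its squared error are determined by \<open>S\<close>.  That
  \<open>f 0 * p 0\<close> is real is what makes convergence of \<open>p n 0\<close> a statement about the scalars \<open>S\<close>.
\<close>

lemma optimal_approximant_orthonormal:
  assumes f: "f \<in> H2"
    and p: "optimal_approximant f n p"
    and \<phi>: "\<And>k. k \<le> n \<Longrightarrow> \<phi> k \<in> polys k"
    and ob: "orthonormal_basis n (\<lambda>k. f \<star> \<phi> k) ((\<lambda>r. f \<star> r) ` polys n)"
  defines "S \<equiv> \<Sum>k\<le>n. (norm (f 0 * \<phi> k 0))\<^sup>2"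
  shows "f 0 * p 0 = of_real S"
    and "normsq (\<lambda>m. conv (ps_coeffs f) (ps_coeffs p) m - delta m) = 1 - S"
proof -
  define a where "a = ps_coeffs f"
  define E where "E k = conv a (ps_coeffs (\<phi> k))" for k
  have E: "has_ps_coeffs (f \<star> \<phi> k) (E k)" "E k \<in> ell2" if "k \<le> n" for k
    using star_poly_coeffs[OF f \<phi>[OF that]] by (auto simp: E_def a_def)
  have a0: "f 0 = a 0"
    using f has_ps_coeffs_zero by (auto simp: H2_iff a_def)
  have E0: "E k 0 = f 0 * \<phi> k 0" if "k \<le> n" for k
    using has_ps_coeffs_zero[OF polys_coeffs(1)[OF \<phi>[OF that]]] by (simp add: E_def a0)
  have S: "S = (\<Sum>k\<le>n. (norm (E k 0))\<^sup>2)"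
    unfolding S_def by (rule sum.cong) (simp_all add: E0)
  have on: "ell2_inner (E j) (E k) = (if j = k then 1 else 0)" if "j \<le> n" "k \<le> n" for j k
    using ob that E(1)[THEN ps_coeffs_eqI] unfolding orthonormal_basis_def H2_inner_def ell2_inner_def
    by simp
  have dist: "normsq (\<lambda>m. (\<Sum>k\<le>n. E k m * c k) - delta m)
      = 1 - S + (\<Sum>k\<le>n. (norm (c k - qcnj (E k 0)))\<^sup>2)" for c
    unfolding S by (intro normsq_orthonormal_combination_diff_delta E(2) on)
  have p_polys: "p \<in> polys n"
    using p by (simp add: optimal_approximant_def)
  note fp = star_poly_coeffs[OF f p_polys, folded a_def]
  obtain d where d: "conv a (ps_coeffs p) = (\<lambda>m. \<Sum>k\<le>n. E k m * d k)"
  proof -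
    have "f \<star> p \<in> right_span ((\<lambda>k. f \<star> \<phi> k) ` {..n})"
      using ob p_polys unfolding orthonormal_basis_def by blast
    then obtain J c where J: "finite J" "J \<subseteq> {..n}"
      and h: "\<forall>q\<in>ball 0 1. (f \<star> p) q = (\<Sum>k\<in>J. (f \<star> \<phi> k) q * c k)"
      unfolding right_span_image_iff by blast
    have "has_ps_coeffs (\<lambda>q. \<Sum>k\<in>J. (f \<star> \<phi> k) q * c k) (\<lambda>m. \<Sum>k\<in>J. E k m * c k)"
      by (intro has_ps_coeffs_sum has_ps_coeffs_mult_right E) (use J in auto)
    then have "has_ps_coeffs (f \<star> p) (\<lambda>m. \<Sum>k\<in>J. E k m * c k)"
      by (rule has_ps_coeffs_cong) (use h in auto)
    then have "conv a (ps_coeffs p) = (\<lambda>m. \<Sum>k\<in>J. E k m * c k)"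
      using fp(1) has_ps_coeffs_unique by blast
    also have "\<dots> = (\<lambda>m. \<Sum>k\<le>n. E k m * (if k \<in> J then c k else 0))"
      by (rule ext, rule sum.mono_neutral_cong_left) (use J in auto)
    finally show ?thesis by (rule that)
  qed
  \<comment> \<open>The orthogonal projection of the constant 1 is a competitor in the minimisation.\<close>
  define r where "r = (\<lambda>m. \<Sum>k\<le>n. ps_coeffs (\<phi> k) m * qcnj (E k 0))"
  have conv_r: "conv a r = (\<lambda>m. \<Sum>k\<le>n. E k m * qcnj (E k 0))"
    by (simp add: r_def conv_sum conv_mult_right E_def)
  have "ps_coeffs (\<phi> k) m = 0" if "k \<le> n" "m > n" for k m
    using polys_coeffs(2)[OF \<phi>[OF that(1)]] that by simp
  then have "\<forall>m>n. r m = 0"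
    by (simp add: r_def)
  then have "normsq (\<lambda>m. conv a (ps_coeffs p) m - delta m) \<le> normsq (\<lambda>m. conv a r m - delta m)"
    unfolding a_def by (rule optimal_approximant_normsq_le[OF f p])
  then have "(\<Sum>k\<le>n. (norm (d k - qcnj (E k 0)))\<^sup>2) \<le> 0"
    unfolding d conv_r dist by simp
  then have d_eq: "d k = qcnj (E k 0)" if "k \<le> n" for k
    using that sum_nonneg_eq_0_iff[of "{..n}" "\<lambda>k. (norm (d k - qcnj (E k 0)))\<^sup>2"]
    by (simp add: order_antisym sum_nonneg)
  show "normsq (\<lambda>m. conv (ps_coeffs f) (ps_coeffs p) m - delta m) = 1 - S"
    unfolding a_def[symmetric] d dist by (simp add: d_eq)
  have "f 0 * p 0 = conv a (ps_coeffs p) 0"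
    using has_ps_coeffs_zero[OF polys_coeffs(1)[OF p_polys]] by (simp add: a0)
  also have "\<dots> = (\<Sum>k\<le>n. of_real ((norm (E k 0))\<^sup>2))"
    unfolding d by (rule sum.cong) (simp_all add: d_eq mult_qcnj_self del: of_real_power)
  also have "\<dots> = of_real S"
    by (simp add: S)
  finally show "f 0 * p 0 = of_real S" .
qed

lemma approximable_delta_iff_tendsto:
  assumes f: "f \<in> H2" and p: "\<And>n. optimal_approximant f n (p n)"
  defines "D \<equiv> \<lambda>n. normsq (\<lambda>m. conv (ps_coeffs f) (ps_coeffs (p n)) m - delta m)"
  shows "approximable (poly_multiples (ps_coeffs f)) delta \<longleftrightarrow> D \<longlonglongrightarrow> 0"
proof -
  define a where "a = ps_coeffs f"
  have pn: "p n \<in> polys n" for n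
    using p by (simp add: optimal_approximant_def)
  have D_nonneg: "D n \<ge> 0" for n
    unfolding D_def by (intro normsq_nonneg ell2_diff star_poly_coeffs(2)[OF f pn] ell2_delta)
  show ?thesis
    unfolding a_def[symmetric]
  proof
    assume approx: "approximable (poly_multiples a) delta"
    show "D \<longlonglongrightarrow> 0"
    proof (rule LIMSEQ_I)
      fix \<epsilon> :: real assume "\<epsilon> > 0"
      then obtain r n where r: "\<forall>k>n. r k = 0" "normsq (\<lambda>m. conv a r m - delta m) < \<epsilon>"
        using approx unfolding approximable_def poly_multiples_def by blast
      have "norm (D l - 0) < \<epsilon>" if "l \<ge> n" for l
      proof -
        have "D l \<le> normsq (\<lambda>m. conv a r m - delta m)"
          unfolding D_def a_def
          by (rule optimal_approximant_normsq_le[OF f p]) (use r that in auto)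
        with r D_nonneg[of l] show ?thesis by simp
      qed
      then show "\<exists>n. \<forall>l\<ge>n. norm (D l - 0) < \<epsilon>" by blast
    qed
  next
    assume lim: "D \<longlonglongrightarrow> 0"
    show "approximable (poly_multiples a) delta"
      unfolding approximable_def
    proof (intro allI impI)
      fix \<epsilon> :: real assume "\<epsilon> > 0"
      then obtain n where "D n < \<epsilon>"
        using order_tendstoD(2)[OF lim] eventually_happens'[OF sequentially_bot] by blast
      moreover have "conv a (ps_coeffs (p n)) \<in> poly_multiples a"
        unfolding poly_multiples_def using polys_coeffs(2)[OF pn] by blast
      ultimately show "\<exists>w\<in>poly_multiples a. normsq (\<lambda>m. w m - delta m) < \<epsilon>"
        unfolding D_def a_def by blast
    qed
  qed
qed

theorem theorem5p2:
  fixes f :: "quat \<Rightarrow> quat" and p \<phi> :: "nat \<Rightarrow> quat \<Rightarrow> quat"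
  assumes "f \<in> H2" and "f 0 \<noteq> 0"
    and "\<And>n. optimal_approximant f n (p n)"
    and "\<And>k. \<phi> k \<in> polys k"
    and "\<And>n. orthonormal_basis n (\<lambda>k. f \<star> \<phi> k) ((\<lambda>r. f \<star> r) ` polys n)"
  shows "(cyclic f \<longleftrightarrow> (\<lambda>n. p n 0) \<longlonglongrightarrow> star_inverse f 0) \<and>
         ((\<lambda>n. p n 0) \<longlonglongrightarrow> star_inverse f 0 \<longleftrightarrow>
            (\<lambda>k. (norm (\<phi> k 0))\<^sup>2) sums (norm (star_inverse f 0))\<^sup>2)"
proof -
  define S where "S n = (\<Sum>k\<le>n. (norm (f 0 * \<phi> k 0))\<^sup>2)" for n
  have S: "f 0 * p n 0 = of_real (S n)"
    "normsq (\<lambda>m. conv (ps_coeffs f) (ps_coeffs (p n)) m - delta m) = 1 - S n" for n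
    using optimal_approximant_orthonormal[of f n "p n" \<phi>] assms by (auto simp: S_def)
  have inv: "star_inverse f 0 = inverse (f 0)"
    by (rule star_inverse_zero[OF assms(1,2)])
  have "cyclic f \<longleftrightarrow> (\<lambda>n. 1 - S n) \<longlonglongrightarrow> 0"
    using cyclic_iff_approximable[OF assms(1)] approximable_delta_iff_tendsto[OF assms(1,3)]
    by (simp add: S)
  also have "\<dots> \<longleftrightarrow> S \<longlonglongrightarrow> 1"
    using LIM_zero_iff[of S 1 sequentially] tendsto_minus_cancel_left[of "\<lambda>n. S n - 1" 0 sequentially]
    by simp
  finally have cyc: "cyclic f \<longleftrightarrow> S \<longlonglongrightarrow> 1" .
  have p_eq: "p n 0 = inverse (f 0) * of_real (S n)" for n
    using assms(2) by (simp add: S(1)[symmetric] mult.assoc[symmetric])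
  have "(\<lambda>n. p n 0) \<longlonglongrightarrow> star_inverse f 0 \<longleftrightarrow> (\<lambda>n. of_real (S n) :: quat) \<longlonglongrightarrow> of_real 1"
  proof
    assume "(\<lambda>n. p n 0) \<longlonglongrightarrow> star_inverse f 0"
    then have "(\<lambda>n. f 0 * p n 0) \<longlonglongrightarrow> f 0 * star_inverse f 0"
      by (rule tendsto_mult_left)
    then show "(\<lambda>n. of_real (S n) :: quat) \<longlonglongrightarrow> of_real 1"
      using assms(2) by (simp add: S inv)
  next
    assume "(\<lambda>n. of_real (S n) :: quat) \<longlonglongrightarrow> of_real 1"
    then have "(\<lambda>n. inverse (f 0) * of_real (S n)) \<longlonglongrightarrow> inverse (f 0) * of_real 1"
      by (rule tendsto_mult_left)
    then show "(\<lambda>n. p n 0) \<longlonglongrightarrow> star_inverse f 0"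
      by (simp add: p_eq inv)
  qed
  also have "\<dots> \<longleftrightarrow> S \<longlonglongrightarrow> 1"
    by (rule tendsto_of_real_iff)
  finally have lim: "(\<lambda>n. p n 0) \<longlonglongrightarrow> star_inverse f 0 \<longleftrightarrow> S \<longlonglongrightarrow> 1" .
  have "S \<longlonglongrightarrow> 1 \<longleftrightarrow> (\<lambda>k. (norm (f 0))\<^sup>2 * (norm (\<phi> k 0))\<^sup>2) sums
      ((norm (f 0))\<^sup>2 * (norm (star_inverse f 0))\<^sup>2)"
    using assms(2)
    by (simp add: sums_def_le S_def[abs_def] inv norm_mult norm_inverse power_mult_distrib[symmetric])
  also have "\<dots> \<longleftrightarrow> (\<lambda>k. (norm (\<phi> k 0))\<^sup>2) sums (norm (star_inverse f 0))\<^sup>2"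
    using assms(2) by (intro sums_mult_iff) simp
  finally show ?thesis
    using cyc lim by simp
qed

end
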